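(* Let $p$ be a probability distribution on $\mathbb{R}^D$, let $x\in\mathbb{R}^D$ be fixed, and let $y,y_1,y_2,\dots$ be i.i.d. with distribution $p$. Let $w=k(x,y)$, and assume that for some constants $M,C>0$ one has $w\in[0,M]$ and $\|y\|\le C$ almost surely, that $\Pr(w>0)=1$, and that $\mathbb{E}[w]>0$. Let $T^*=\mathbb{E}[wy]/\mathbb{E}[w]$ be the target centroid and let $T_n^{\mathrm{ABC}}$ be the analytically bias-corrected (ABC) centroid of $y_1,\dots,y_n$. Then, as $n\to\infty$, $$\mathbb{E}\bigl[T_n^{\mathrm{ABC}}-T^*\bigr]=O(n^{-2}).$$
   Context: $k:\mathbb{R}^D\times\mathbb{R}^D\to\mathbb{R}$ is a kernel (with $k(x,\cdot)$ measurable), and $\|\cdot\|$ is the Euclidean norm. With $w_i=k(x,y_i)$ and $\alpha_i=w_i/\sum_{j=1}^n w_j$ (well defined on the event $\sum_{j=1}^n w_j>0$, which has probability one under the hypotheses), the minibatch centroid is $T_n:=\sum_{i=1}^n\alpha_i y_i$, the plug-in correction is $\Delta_n:=\sum_{i=1}^n\alpha_i^2\,(T_n-y_i)$, and the ABC centroid is $$T_n^{\mathrm{ABC}}:=T_n-\Delta_n=\Bigl(1-\sum_{i=1}^n\alpha_i^2\Bigr)T_n+\sum_{i=1}^n\alpha_i^2\,y_i.$$ The distribution $p$, kernel $k$ and query $x$ do not depend on $n$; $O(n^{-2})$ denotes a vector in $\mathbb{R}^D$ whose norm is at most a constant (independent of $n$) times $n^{-2}$ for all sufficiently large $n$. *)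

theory Defs
  imports "HOL-Probability.Probability" "HOL-Library.Landau_Symbols"
begin

text \<open>A minibatch of size \<open>n\<close> consists of the entries \<open>ys 1, \<dots>, ys n\<close> of a sequence
  \<open>ys\<close>; the entry \<open>ys 0\<close> is never used. If all the weights in a minibatch sum to zero, the
  normalised weights are all \<open>0\<close> (division by zero); this happens with probability zero when
  the weights are almost surely positive and \<open>n \<ge> 1\<close>.\<close>

definition normalized_weight ::
  "(real^'d \<Rightarrow> real^'d \<Rightarrow> real) \<Rightarrow> real^'d \<Rightarrow> (nat \<Rightarrow> real^'d) \<Rightarrow> nat \<Rightarrow> nat \<Rightarrow> real" where
  "normalized_weight k x ys n i = k x (ys i) / (\<Sum>j=1..n. k x (ys j))"

definition minibatch_centroid ::
  "(real^'d \<Rightarrow> real^'d \<Rightarrow> real) \<Rightarrow> real^'d \<Rightarrow> (nat \<Rightarrow> real^'d) \<Rightarrow> nat \<Rightarrow> real^'d" where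
  "minibatch_centroid k x ys n = (\<Sum>i=1..n. normalized_weight k x ys n i *\<^sub>R ys i)"

definition plugin_correction ::
  "(real^'d \<Rightarrow> real^'d \<Rightarrow> real) \<Rightarrow> real^'d \<Rightarrow> (nat \<Rightarrow> real^'d) \<Rightarrow> nat \<Rightarrow> real^'d" where
  "plugin_correction k x ys n =
     (\<Sum>i=1..n. (normalized_weight k x ys n i)\<^sup>2 *\<^sub>R (minibatch_centroid k x ys n - ys i))"

definition abc_centroid ::
  "(real^'d \<Rightarrow> real^'d \<Rightarrow> real) \<Rightarrow> real^'d \<Rightarrow> (nat \<Rightarrow> real^'d) \<Rightarrow> nat \<Rightarrow> real^'d" where
  "abc_centroid k x ys n = minibatch_centroid k x ys n - plugin_correction k x ys n"

lemma abc_centroid_alt: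
  "abc_centroid k x ys n =
     (1 - (\<Sum>i=1..n. (normalized_weight k x ys n i)\<^sup>2)) *\<^sub>R minibatch_centroid k x ys n
     + (\<Sum>i=1..n. (normalized_weight k x ys n i)\<^sup>2 *\<^sub>R ys i)"
  unfolding abc_centroid_def plugin_correction_def
  by (simp add: scaleR_diff_right sum_subtractf scaleR_left.sum scaleR_diff_left)

definition target_centroid ::
  "(real^'d) measure \<Rightarrow> (real^'d \<Rightarrow> real^'d \<Rightarrow> real) \<Rightarrow> real^'d \<Rightarrow> real^'d" where
  "target_centroid p k x =
     prob_space.expectation p (\<lambda>y. k x y *\<^sub>R y) /\<^sub>R prob_space.expectation p (\<lambda>y. k x y)"

end

theory Submission
  imports Defs "HOL-Probability.Hoeffding" "HOL-Real_Asymp.Real_Asymp"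
begin

text \<open>Write \<open>S\<close> and \<open>Q\<close> for the sums of the weights and of their squares, and
  \<open>v\<^sub>j = w\<^sub>j (y\<^sub>j - T\<^sup>*)\<close>, which is centred. The error of the ABC centroid is
  \<open>\<Sum>\<^sub>j (1 / S - Q / S\<^sup>3 + w\<^sub>j / S\<^sup>2) v\<^sub>j\<close>. If \<open>A\<close> and \<open>B\<close> are the sums without the
  \<open>j\<close>-th sample, then on the event that \<open>A\<close> is of order \<open>n\<close> the scalar factor equals
  \<open>1 / A - B / A\<^sup>3\<close> up to \<open>O(n\<^sup>-\<^sup>3)\<close>: the term \<open>w\<^sub>j / S\<^sup>2\<close> coming from the correction cancels
  the first-order dependence of \<open>1 / S\<close> on \<open>w\<^sub>j\<close>. Since \<open>A\<close> and \<open>B\<close>, and hence also the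
  event, are independent of \<open>v\<^sub>j\<close>, the main term has expectation zero. On the complementary
  event, which has exponentially small probability by Hoeffding's inequality, the summand is
  bounded; truncating there is necessary because \<open>1 / A\<close> need not be integrable.\<close>

section \<open>Deterministic estimates for one summand\<close>

text \<open>With \<open>t = w + s\<close>, the difference splits into
  \<open>1 / t - 1 / s + w / t\<^sup>2\<close>, the term \<open>- w\<^sup>2 / t ^ 3\<close>, and
  \<open>q / s ^ 3 - q / t ^ 3\<close>. Each is a product of two quantities bounded by
  \<open>m\<close> over three factors at least \<open>c\<close>, which gives the constant 1 + 1 + 3
  = 5.\<close>

lemma abc_factor_expansion:
  fixes s q w m c :: real
  assumes c: "0 < c" "c \<le> s" and w: "0 \<le> w" "w \<le> m" and q: "0 \<le> q" "q \<le> m * s"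
  shows "\<bar>(1 / (w + s) - (w\<^sup>2 + q) / (w + s) ^ 3 + w / (w + s)\<^sup>2) - (1 / s - q / s ^ 3)\<bar>
           \<le> 5 * m\<^sup>2 / c ^ 3"
proof -
  define t where "t = w + s"
  have pos: "0 < s" "0 < t" "s \<le> t" "w \<le> t"
    using c w by (auto simp: t_def)
  have c3: "c ^ 3 \<le> a * b" if "c \<le> a" "c\<^sup>2 \<le> b" for a b
    using mult_mono[OF that] that c by (simp add: power3_eq_cube power2_eq_square mult.assoc)
  have c2: "c\<^sup>2 \<le> a * b" if "c \<le> a" "c \<le> b" for a b
    using mult_mono[OF that] that c by (simp add: power2_eq_square)
  have frac: "a / d \<le> b / c ^ 3" if "0 \<le> a" "a \<le> b" "c ^ 3 \<le> d" for a b d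
    using that c by (intro frac_le) auto
  have ct: "c \<le> t"
    using c pos by linarith
  have w2: "w\<^sup>2 \<le> m\<^sup>2"
    using w by (intro power_mono)
  \<comment> \<open>The cancellation: \<open>1 / s - 1 / t\<close> is \<open>w / (s * t)\<close>,
    and replacing \<open>s\<close> by \<open>t\<close> in it changes it only at second order in
    \<open>w\<close>.\<close>
  have "1 / t - 1 / s + w / t\<^sup>2 = - (w\<^sup>2 / (s * (t * t)))"
  proof -
    have w_eq: "w = t - s"
      by (simp add: t_def)
    show ?thesis
      unfolding w_eq using pos by (simp add: field_simps power2_eq_square)
  qed
  moreover have "w\<^sup>2 / (s * (t * t)) \<le> m\<^sup>2 / c ^ 3"
    using c ct w2 by (intro frac c3 c2) auto
  moreover have "0 \<le> w\<^sup>2 / (s * (t * t))"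
    using pos by simp
  ultimately have b1: "\<bar>1 / t - 1 / s + w / t\<^sup>2\<bar> \<le> m\<^sup>2 / c ^ 3"
    by linarith
  have "w\<^sup>2 / t ^ 3 \<le> m\<^sup>2 / c ^ 3"
    using c ct w by (intro frac power_mono) auto
  then have b2: "\<bar>w\<^sup>2 / t ^ 3\<bar> \<le> m\<^sup>2 / c ^ 3"
    using pos by simp
  have "t ^ 3 - s ^ 3 = w * (t\<^sup>2 + t * s + s\<^sup>2)"
    by (simp add: t_def power2_eq_square power3_eq_cube algebra_simps)
  also have "\<dots> \<le> w * (3 * t\<^sup>2)"
  proof -
    have "t * s \<le> t * t" "s * s \<le> t * t"
      using pos by (auto intro!: mult_mono)
    then show ?thesis
      using w by (intro mult_left_mono) (auto simp: power2_eq_square)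
  qed
  finally have diff: "t ^ 3 - s ^ 3 \<le> 3 * w * t\<^sup>2"
    by simp
  have eq: "q / s ^ 3 - q / t ^ 3 = q * (t ^ 3 - s ^ 3) / (s ^ 3 * t ^ 3)"
    using pos by (simp add: field_simps)
  have "s ^ 3 \<le> t ^ 3"
    using pos by (intro power_mono) auto
  then have nonneg: "0 \<le> q / s ^ 3 - q / t ^ 3"
    unfolding eq using pos q by auto
  \<comment> \<open>The bound \<open>q \<le> m * s\<close> removes one factor \<open>s\<close>,
    while \<open>diff\<close> supplies the second small factor \<open>w\<close> and removes
    \<open>t\<^sup>2\<close>; a denominator of degree three remains.\<close>
  have "q * (t ^ 3 - s ^ 3) / (s ^ 3 * t ^ 3) \<le> (m * s) * (3 * w * t\<^sup>2) / (s ^ 3 * t ^ 3)"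
    using q diff pos w \<open>s ^ 3 \<le> t ^ 3\<close> by (intro divide_right_mono mult_mono) auto
  also have "\<dots> = 3 * m * w / (s * (s * t))"
    using pos by (simp add: field_simps power2_eq_square power3_eq_cube)
  also have "\<dots> \<le> 3 * m\<^sup>2 / c ^ 3"
    using c ct w by (intro frac c3 c2) (auto simp: power2_eq_square intro!: mult_left_mono)
  finally have b3: "\<bar>q / s ^ 3 - q / t ^ 3\<bar> \<le> 3 * m\<^sup>2 / c ^ 3"
    using nonneg unfolding eq by simp
  have "(1 / t - (w\<^sup>2 + q) / t ^ 3 + w / t\<^sup>2) - (1 / s - q / s ^ 3)
      = (1 / t - 1 / s + w / t\<^sup>2) - w\<^sup>2 / t ^ 3 + (q / s ^ 3 - q / t ^ 3)"
    by (simp add: add_divide_distrib)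
  moreover have "5 * m\<^sup>2 / c ^ 3 = m\<^sup>2 / c ^ 3 + m\<^sup>2 / c ^ 3 + 3 * m\<^sup>2 / c ^ 3"
    by simp
  ultimately show ?thesis
    using b1 b2 b3 unfolding t_def by linarith
qed

text \<open>Pull out \<open>v / S\<close>, which is at most \<open>K\<close> in absolute value
  because \<open>w \<le> S\<close>; what is left is a sum of three terms of size at most 1. No lower
  bound on \<open>S\<close> enters, so this serves on the event where the sum of weights is
  small.\<close>

lemma abc_summand_bound:
  fixes S Q w v K :: real
  assumes w: "0 \<le> w" "w \<le> S" and Q: "0 \<le> Q" "Q \<le> S\<^sup>2" and v: "\<bar>v\<bar> \<le> K * w"
    and K: "0 \<le> K"
  shows "\<bar>v * (1 / S - Q / S ^ 3 + w / S\<^sup>2)\<bar> \<le> 3 * K"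
proof (cases "w = 0")
  \<comment> \<open>Here \<open>v = 0\<close>; this case also covers \<open>S = 0\<close>.\<close>
  case True
  then show ?thesis using v K by simp
next
  case False
  then have pos: "0 < w" "0 < S"
    using w by auto
  have "\<bar>v\<bar> \<le> K * S"
    using v mult_left_mono[OF w(2) K] by linarith
  then have vS: "\<bar>v / S\<bar> \<le> K"
    using pos by (simp add: field_simps)
  have "\<bar>Q / S\<^sup>2\<bar> \<le> 1" "\<bar>w / S\<bar> \<le> 1"
    using Q w pos by (auto simp: field_simps)
  then have "\<bar>1 - Q / S\<^sup>2 + w / S\<bar> \<le> 3"
    by linarith
  with vS have "\<bar>v / S\<bar> * \<bar>1 - Q / S\<^sup>2 + w / S\<bar> \<le> K * 3"
    using K by (intro mult_mono) auto
  moreover have "v * (1 / S - Q / S ^ 3 + w / S\<^sup>2) = v / S * (1 - Q / S\<^sup>2 + w / S)"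
    by (simp add: algebra_simps power2_eq_square power3_eq_cube)
  ultimately show ?thesis
    by (simp add: abs_mult)
qed

section \<open>Expectation of one summand\<close>

context prob_space
begin

text \<open>The intended \<open>V\<close> is \<open>k x y * ((y - t) \<bullet> u)\<close> for a unit
  vector \<open>u\<close>, so that \<open>F\<close> is one coordinate of one summand of the error. A
  bound of order \<open>n\<^sup>-\<^sup>3\<close> per summand is what \<open>n\<close> summands
  require. The factor 320 is \<open>5 * 4 ^ 3\<close>, from the expansion constant and the threshold
  \<open>c = \<mu> * n / 4\<close>.\<close>

lemma abc_summand_expectation:
  fixes Y :: "'i \<Rightarrow> 'a \<Rightarrow> 'b" and W V :: "'b \<Rightarrow> real"
  assumes fin: "finite I" and indep: "indep_vars (\<lambda>_. N) Y I" and j: "j \<in> I"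
    and card: "card I \<ge> 2"
    and [measurable]: "W \<in> borel_measurable N" "V \<in> borel_measurable N"
    and m: "0 < m" and K: "0 \<le> K"
    and W: "\<And>i. i \<in> I \<Longrightarrow> AE \<omega> in M. W (Y i \<omega>) \<in> {0..m}"
    and V: "AE \<omega> in M. \<bar>V (Y j \<omega>)\<bar> \<le> K * W (Y j \<omega>)"
    and EW: "\<And>i. i \<in> I \<Longrightarrow> expectation (\<lambda>\<omega>. W (Y i \<omega>)) = \<mu>" and \<mu>: "0 < \<mu>"
    and EV: "expectation (\<lambda>\<omega>. V (Y j \<omega>)) = 0"
  defines "S \<equiv> \<lambda>\<omega>. \<Sum>i\<in>I. W (Y i \<omega>)" and "Q \<equiv> \<lambda>\<omega>. \<Sum>i\<in>I. (W (Y i \<omega>))\<^sup>2"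
  defines "n \<equiv> real (card I)"
  defines "F \<equiv> \<lambda>\<omega>. V (Y j \<omega>) * (1 / S \<omega> - Q \<omega> / S \<omega> ^ 3 + W (Y j \<omega>) / (S \<omega>)\<^sup>2)"
  shows "integrable M F"
    and "\<bar>expectation F\<bar> \<le> 320 * K * m ^ 3 / (\<mu> * n) ^ 3 + 3 * K * exp (- (\<mu>\<^sup>2 / (8 * m\<^sup>2)) * n)"
proof -
  have Y[measurable]: "Y i \<in> measurable M N" if "i \<in> I" for i
    using indep that by (auto simp: indep_vars_def)
  note [measurable] = Y[OF j]
  define J where "J = I - {j}"
  have J: "finite J" "J \<subseteq> I" "j \<notin> J" "I = insert j J"
    using fin j by (auto simp: J_def)
  define A where "A \<omega> = (\<Sum>i\<in>J. W (Y i \<omega>))" for \<omega>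
  define B where "B \<omega> = (\<Sum>i\<in>J. (W (Y i \<omega>))\<^sup>2)" for \<omega>
  have SQ: "S \<omega> = W (Y j \<omega>) + A \<omega>" "Q \<omega> = (W (Y j \<omega>))\<^sup>2 + B \<omega>" for \<omega>
    using J by (auto simp: S_def Q_def A_def B_def)
  have [measurable]: "A \<in> borel_measurable M" "B \<in> borel_measurable M"
  proof -
    have "(\<lambda>\<omega>. W (Y i \<omega>)) \<in> borel_measurable M" if "i \<in> J" for i
      using J that by (intro measurable_compose[OF Y]) auto
    then show "A \<in> borel_measurable M" "B \<in> borel_measurable M"
      unfolding A_def B_def by (auto intro!: borel_measurable_sum borel_measurable_power)
  qed
  have [measurable]: "S \<in> borel_measurable M" "Q \<in> borel_measurable M"
    unfolding SQ by measurable
  have [measurable]: "F \<in> borel_measurable M"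
    unfolding F_def by measurable

  have AE_W: "AE \<omega> in M. \<forall>i\<in>I. W (Y i \<omega>) \<in> {0..m}"
    using W fin by (intro AE_finite_allI)
  \<comment> \<open>Of the two upper bounds on \<open>B\<close>, the linear one feeds the expansion
    of the factor; the quadratic one feeds the uniform bound on \<open>F\<close> and the
    integrability of \<open>h\<close>.\<close>
  have AB: "0 \<le> A \<omega>" "0 \<le> B \<omega>" "B \<omega> \<le> m * A \<omega>" "B \<omega> \<le> (A \<omega>)\<^sup>2"
    if "\<forall>i\<in>I. W (Y i \<omega>) \<in> {0..m}" for \<omega>
  proof -
    have w: "0 \<le> W (Y i \<omega>)" "W (Y i \<omega>) \<le> m" if "i \<in> J" for i
      using that \<open>\<forall>i\<in>I. _\<close> J by auto
    show A0: "0 \<le> A \<omega>" and "0 \<le> B \<omega>"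
      unfolding A_def B_def using w by (auto intro!: sum_nonneg)
    show "B \<omega> \<le> m * A \<omega>"
      unfolding A_def B_def sum_distrib_left power2_eq_square
      using w by (intro sum_mono mult_right_mono)
    have "W (Y i \<omega>) \<le> A \<omega>" if "i \<in> J" for i
      unfolding A_def using w J that by (intro member_le_sum) auto
    then have "B \<omega> \<le> (\<Sum>i\<in>J. A \<omega> * W (Y i \<omega>))"
      unfolding B_def power2_eq_square using w by (intro sum_mono mult_right_mono)
    then show "B \<omega> \<le> (A \<omega>)\<^sup>2"
      by (simp add: A_def power2_eq_square sum_distrib_left)
  qed

  \<comment> \<open>The mean of \<open>A\<close> is \<open>(n - 1) * \<mu>\<close>, which is at
    least \<open>2 * c\<close> once \<open>n \<ge> 2\<close>. Hence \<open>A \<le> c\<close> is a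
    deviation of at least \<open>c\<close> below the mean.\<close>
  define c where "c = \<mu> * n / 4"
  have n: "2 \<le> n"
    using card by (simp add: n_def)
  have c: "0 < c"
    using \<mu> n by (simp add: c_def)
  define h where "h a b = (if c \<le> a then 1 / a - b / a ^ 3 else 0)" for a b :: real
  \<comment> \<open>The non-strict inequality matches the lower tail in Hoeffding's inequality. The
    overlap with \<open>c \<le> A\<close> is harmless, since \<open>E\<close> enters only through an
    upper bound.\<close>
  define E where "E = {\<omega>\<in>space M. A \<omega> \<le> c}"
  have [measurable]: "E \<in> sets M"
    unfolding E_def by measurable
  have h_meas[measurable]: "(\<lambda>\<omega>. h (f \<omega>) (g \<omega>)) \<in> borel_measurable L"
    if [measurable]: "f \<in> borel_measurable L" "g \<in> borel_measurable L" for f g and L :: "'z measure"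
    unfolding h_def by measurable

  have F_bound: "AE \<omega> in M. \<bar>F \<omega>\<bar> \<le> 3 * K"
    using AE_W V
  proof eventually_elim
    case (elim \<omega>)
    have w: "0 \<le> W (Y j \<omega>)"
      using elim j by auto
    have "(W (Y j \<omega>))\<^sup>2 + B \<omega> \<le> (W (Y j \<omega>) + A \<omega>)\<^sup>2"
      using AB[OF elim(1)] mult_nonneg_nonneg[OF w AB(1)[OF elim(1)]] by (simp add: power2_sum)
    then show ?case
      unfolding F_def SQ using AB[OF elim(1)] elim w K by (intro abc_summand_bound) auto
  qed
  show F_int: "integrable M F"
    using F_bound by (intro integrable_const_bound[where B = "3 * K"]) auto

  have V_int: "integrable M (\<lambda>\<omega>. V (Y j \<omega>))"
  proof (rule integrable_const_bound)
    show "AE \<omega> in M. norm (V (Y j \<omega>)) \<le> K * m"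
      using W[OF j] V
    proof eventually_elim
      case (elim \<omega>)
      have "K * W (Y j \<omega>) \<le> K * m"
        using elim K by (intro mult_left_mono) auto
      with elim show ?case by simp
    qed
  qed measurable

  have h_int: "integrable M (\<lambda>\<omega>. h (A \<omega>) (B \<omega>))"
  proof (rule integrable_const_bound)
    show "AE \<omega> in M. norm (h (A \<omega>) (B \<omega>)) \<le> 1 / c + 1 / c"
      using AE_W
    proof eventually_elim
      case (elim \<omega>)
      show ?case
      proof (cases "c \<le> A \<omega>")
        case True
        then have "0 < A \<omega>"
          using c by linarith
        have *: "1 / A \<omega> \<le> 1 / c"
          using True c by (simp add: frac_le)
        have "B \<omega> / A \<omega> ^ 3 \<le> (A \<omega>)\<^sup>2 / A \<omega> ^ 3"
          using AB[OF elim] \<open>0 < A \<omega>\<close> by (intro divide_right_mono) auto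
        also have "\<dots> = 1 / A \<omega>"
          using \<open>0 < A \<omega>\<close> by (simp add: power2_eq_square power3_eq_cube)
        finally have "B \<omega> / A \<omega> ^ 3 \<le> 1 / c"
          using * by linarith
        moreover have "0 \<le> B \<omega> / A \<omega> ^ 3" "0 \<le> 1 / A \<omega>"
          using AB[OF elim] by auto
        ultimately show ?thesis
          using True * by (simp add: h_def del: divide_nonneg_nonneg zero_le_divide_1_iff)
      qed (use c in \<open>simp add: h_def\<close>)
    qed
  qed measurable

  \<comment> \<open>The two variables are functions of the samples indexed by the disjoint sets
    \<open>{j}\<close> and \<open>J\<close>.\<close>
  have "indep_var borel (\<lambda>\<omega>. V (Y j \<omega>)) borel (\<lambda>\<omega>. h (A \<omega>) (B \<omega>))"
  proof -
    have "indep_var borel ((\<lambda>y. V (y j)) \<circ> (\<lambda>\<omega>. \<lambda>i\<in>{j}. Y i \<omega>)) borel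
        ((\<lambda>y. h (\<Sum>i\<in>J. W (y i)) (\<Sum>i\<in>J. (W (y i))\<^sup>2)) \<circ> (\<lambda>\<omega>. \<lambda>i\<in>J. Y i \<omega>))"
      using J by (intro indep_var_compose[OF indep_var_restrict[OF indep]]) auto
    then show ?thesis
      by (simp add: comp_def A_def B_def)
  qed
  from indep_var_lebesgue_integral[OF this V_int h_int] indep_var_integrable[OF this V_int h_int]
  have Vh: "integrable M (\<lambda>\<omega>. V (Y j \<omega>) * h (A \<omega>) (B \<omega>))"
      "expectation (\<lambda>\<omega>. V (Y j \<omega>) * h (A \<omega>) (B \<omega>)) = 0"
    by (simp_all add: EV)

  \<comment> \<open>Where \<open>c \<le> A\<close>, the difference is \<open>V\<close> times the
    expansion remainder; elsewhere \<open>h\<close> vanishes and the uniform bound on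
    \<open>F\<close> applies.\<close>
  have diff: "AE \<omega> in M. \<bar>F \<omega> - V (Y j \<omega>) * h (A \<omega>) (B \<omega>)\<bar>
      \<le> K * m * (5 * m\<^sup>2 / c ^ 3) + 3 * K * indicator E \<omega>"
    using AE_W V F_bound AE_space
  proof eventually_elim
    case (elim \<omega>)
    show ?case
    proof (cases "c \<le> A \<omega>")
      case True
      have w: "0 \<le> W (Y j \<omega>)" "W (Y j \<omega>) \<le> m"
        using elim j by auto
      have "K * W (Y j \<omega>) \<le> K * m"
        using w K by (intro mult_left_mono) auto
      then have "\<bar>V (Y j \<omega>)\<bar> \<le> K * m"
        using elim by linarith
      then have "\<bar>V (Y j \<omega>)\<bar> * \<bar>(1 / S \<omega> - Q \<omega> / S \<omega> ^ 3 + W (Y j \<omega>) / (S \<omega>)\<^sup>2)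
            - (1 / A \<omega> - B \<omega> / A \<omega> ^ 3)\<bar> \<le> K * m * (5 * m\<^sup>2 / c ^ 3)"
        unfolding SQ using True c w AB[OF elim(1)] K m
        by (intro mult_mono abc_factor_expansion) auto
      moreover have "F \<omega> - V (Y j \<omega>) * h (A \<omega>) (B \<omega>) =
          V (Y j \<omega>) * ((1 / S \<omega> - Q \<omega> / S \<omega> ^ 3 + W (Y j \<omega>) / (S \<omega>)\<^sup>2)
            - (1 / A \<omega> - B \<omega> / A \<omega> ^ 3))"
        using True by (simp add: F_def h_def right_diff_distrib)
      moreover have "0 \<le> 3 * K * (indicator E \<omega> :: real)"
        using K by simp
      ultimately show ?thesis
        by (simp only: abs_mult)
    next
      case False
      have "0 \<le> K * m * (5 * m\<^sup>2 / c ^ 3)"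
        using K m c by auto
      then show ?thesis
        using False elim by (simp add: h_def E_def)
    qed
  qed

  have E_int: "integrable M (\<lambda>\<omega>. 3 * K * indicator E \<omega>)"
    by (intro integrable_mult_right integrable_real_indicator) (auto simp: emeasure_eq_measure)
  then have bound_int: "integrable M (\<lambda>\<omega>. K * m * (5 * m\<^sup>2 / c ^ 3) + 3 * K * indicator E \<omega>)"
    by (intro Bochner_Integration.integrable_add integrable_const)
  have "\<bar>expectation F\<bar> = \<bar>expectation (\<lambda>\<omega>. F \<omega> - V (Y j \<omega>) * h (A \<omega>) (B \<omega>))\<bar>"
    using F_int Vh by simp
  also have "\<dots> \<le> expectation (\<lambda>\<omega>. \<bar>F \<omega> - V (Y j \<omega>) * h (A \<omega>) (B \<omega>)\<bar>)"
    by (rule integral_abs_bound)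
  also have "\<dots> \<le> expectation (\<lambda>\<omega>. K * m * (5 * m\<^sup>2 / c ^ 3) + 3 * K * indicator E \<omega>)"
    using F_int Vh(1) by (intro integral_mono_AE[OF _ bound_int diff]) simp
  also have "\<dots> = K * m * (5 * m\<^sup>2 / c ^ 3) + 3 * K * prob E"
    by (subst Bochner_Integration.integral_add[OF integrable_const E_int]) (simp add: prob_space)
  also have "K * m * (5 * m\<^sup>2 / c ^ 3) = 320 * K * m ^ 3 / (\<mu> * n) ^ 3"
    by (simp add: c_def power_divide power2_eq_square power3_eq_cube)
  finally have main: "\<bar>expectation F\<bar> \<le> 320 * K * m ^ 3 / (\<mu> * n) ^ 3 + 3 * K * prob E" .

  have "prob E \<le> exp (- (\<mu>\<^sup>2 / (8 * m\<^sup>2)) * n)"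
  proof -
    interpret H: Hoeffding_ineq M J "\<lambda>i \<omega>. W (Y i \<omega>)" "\<lambda>_. 0" "\<lambda>_. m"
        "\<Sum>i\<in>J. expectation (\<lambda>\<omega>. W (Y i \<omega>))"
    proof unfold_locales
      show "indep_vars (\<lambda>_. borel) (\<lambda>i \<omega>. W (Y i \<omega>)) J"
        by (intro indep_vars_compose2[OF indep_vars_subset[OF indep J(2)]]) simp
    qed (use J W in auto)
    have cJ: "real (card J) = n - 1"
      using fin j card by (simp add: J_def n_def of_nat_diff)
    have mean: "(\<Sum>i\<in>J. expectation (\<lambda>\<omega>. W (Y i \<omega>))) = (n - 1) * \<mu>"
      using EW J cJ by auto
    define \<epsilon> where "\<epsilon> = (n - 1) * \<mu> - c"
    have "4 * \<epsilon> - 4 * c = 2 * ((n - 2) * \<mu>)"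
      by (simp add: \<epsilon>_def c_def algebra_simps)
    moreover have "0 \<le> (n - 2) * \<mu>"
      using n \<mu> by simp
    ultimately have \<epsilon>: "c \<le> \<epsilon>"
      by linarith
    have "prob E \<le> exp (- 2 * \<epsilon>\<^sup>2 / ((n - 1) * m\<^sup>2))"
      using H.Hoeffding_ineq_le[of \<epsilon>] \<epsilon> c n m cJ unfolding mean
      by (simp add: E_def A_def \<epsilon>_def)
    also have "\<dots> \<le> exp (- (\<mu>\<^sup>2 / (8 * m\<^sup>2)) * n)"
    proof -
      \<comment> \<open>The rate comes from replacing \<open>\<epsilon>\<close> by the smaller
        \<open>c\<close> and \<open>n - 1\<close> by the larger \<open>n\<close> in Hoeffding's
        exponent.\<close>
      have "\<mu>\<^sup>2 / (8 * m\<^sup>2) * n = 2 * c\<^sup>2 / (n * m\<^sup>2)"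
        using n m by (simp add: c_def field_simps power2_eq_square)
      also have "\<dots> \<le> 2 * \<epsilon>\<^sup>2 / ((n - 1) * m\<^sup>2)"
        using n m \<epsilon> c by (intro frac_le mult_left_mono power_mono mult_right_mono) auto
      finally show ?thesis
        by simp
    qed
    finally show ?thesis .
  qed
  then have "3 * K * prob E \<le> 3 * K * exp (- (\<mu>\<^sup>2 / (8 * m\<^sup>2)) * n)"
    using K by (intro mult_left_mono) auto
  with main show "\<bar>expectation F\<bar> \<le> 320 * K * m ^ 3 / (\<mu> * n) ^ 3
      + 3 * K * exp (- (\<mu>\<^sup>2 / (8 * m\<^sup>2)) * n)"
    by linarith
qed

end

section \<open>Algebraic decomposition of the error\<close>

text \<open>The normalized weights \<open>a i\<close> sum to 1 and their squares to
  \<open>q / s\<^sup>2\<close>, so \<open>t\<close> can be subtracted inside both sums of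
  \<open>abc_centroid_alt\<close>. The vector \<open>t\<close> is arbitrary here; taking the target
  centroid makes \<open>k x y *\<^sub>R (y - t)\<close> centred.\<close>

lemma abc_centroid_error:
  fixes k :: "real^'d \<Rightarrow> real^'d \<Rightarrow> real" and x t :: "real^'d"
  defines "S \<equiv> \<lambda>ys n. \<Sum>i=1..n. k x (ys i)" and "Q \<equiv> \<lambda>ys n. \<Sum>i=1..n. (k x (ys i))\<^sup>2"
  assumes S: "S ys n \<noteq> 0"
  shows "abc_centroid k x ys n - t =
    (\<Sum>i=1..n. (1 / S ys n - Q ys n / S ys n ^ 3 + k x (ys i) / (S ys n)\<^sup>2)
        *\<^sub>R (k x (ys i) *\<^sub>R (ys i - t)))"
proof -
  define s q where "s = S ys n" and "q = Q ys n"
  define a where "a i = normalized_weight k x ys n i" for i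
  have a: "a i = k x (ys i) / s" for i
    by (simp add: a_def normalized_weight_def s_def S_def)
  have sum_a: "(\<Sum>i=1..n. a i) = 1"
    using S by (simp add: a s_def S_def flip: sum_divide_distrib)
  have sum_a2: "(\<Sum>i=1..n. (a i)\<^sup>2) = q / s\<^sup>2"
    by (simp add: a q_def Q_def power_divide flip: sum_divide_distrib)
  have T: "minibatch_centroid k x ys n - t = (\<Sum>i=1..n. a i *\<^sub>R (ys i - t))"
    using sum_a by (simp add: minibatch_centroid_def a_def scaleR_diff_right sum_subtractf
        flip: scaleR_left.sum)
  have P: "(\<Sum>i=1..n. (a i)\<^sup>2 *\<^sub>R ys i) - (q / s\<^sup>2) *\<^sub>R t = (\<Sum>i=1..n. (a i)\<^sup>2 *\<^sub>R (ys i - t))"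
    by (simp add: scaleR_diff_right sum_subtractf flip: sum_a2 scaleR_left.sum)
  have "abc_centroid k x ys n - t = (1 - q / s\<^sup>2) *\<^sub>R (minibatch_centroid k x ys n - t)
      + ((\<Sum>i=1..n. (a i)\<^sup>2 *\<^sub>R ys i) - (q / s\<^sup>2) *\<^sub>R t)"
    unfolding abc_centroid_alt a_def[symmetric] sum_a2 by (simp add: algebra_simps)
  also have "\<dots> = (\<Sum>i=1..n. ((1 - q / s\<^sup>2) * a i + (a i)\<^sup>2) *\<^sub>R (ys i - t))"
    unfolding T P by (simp add: scaleR_sum_right scaleR_add_left flip: sum.distrib)
  also have "\<dots> = (\<Sum>i=1..n. (1 / s - q / s ^ 3 + k x (ys i) / s\<^sup>2)
        *\<^sub>R (k x (ys i) *\<^sub>R (ys i - t)))"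
  proof (intro sum.cong refl)
    fix i
    have "(1 - q / s\<^sup>2) * a i + (a i)\<^sup>2 = (1 / s - q / s ^ 3 + k x (ys i) / s\<^sup>2) * k x (ys i)"
      by (simp add: a algebra_simps power2_eq_square power3_eq_cube)
    then show "((1 - q / s\<^sup>2) * a i + (a i)\<^sup>2) *\<^sub>R (ys i - t) =
        (1 / s - q / s ^ 3 + k x (ys i) / s\<^sup>2) *\<^sub>R (k x (ys i) *\<^sub>R (ys i - t))"
      by simp
  qed
  finally show ?thesis
    by (simp add: s_def q_def)
qed

section \<open>Summation over the minibatch and asymptotics\<close>

theorem theorem4p1:
  fixes p :: "(real^'d) measure"
    and k :: "real^'d \<Rightarrow> real^'d \<Rightarrow> real"
    and x :: "real^'d"
    and \<Omega> :: "'w measure"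
    and Y :: "nat \<Rightarrow> 'w \<Rightarrow> real^'d"
    and M C :: real
  assumes "prob_space p" and "sets p = sets borel"
    and "k x \<in> borel_measurable borel"
    and "prob_space \<Omega>"
    and "prob_space.indep_vars \<Omega> (\<lambda>_. borel) Y {1..}"
    and "\<And>i. i \<ge> 1 \<Longrightarrow> distr \<Omega> borel (Y i) = p"
    and "M > 0" and "C > 0"
    and "AE y in p. k x y \<in> {0..M}"
    and "AE y in p. norm y \<le> C"
    and "\<P>(y in p. k x y > 0) = 1"
    and "prob_space.expectation p (\<lambda>y. k x y) > 0"
  shows "(\<lambda>n. norm (prob_space.expectation \<Omega>
            (\<lambda>\<omega>. abc_centroid k x (\<lambda>i. Y i \<omega>) n - target_centroid p k x)))
         \<in> O(\<lambda>n. 1 / real n ^ 2)"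
proof -
  interpret p: prob_space p by fact
  interpret \<Omega>: prob_space \<Omega> by fact
  note [measurable_cong] = \<open>sets p = sets borel\<close>
  note [measurable] = \<open>k x \<in> borel_measurable borel\<close>
  have space_p: "space p = UNIV"
    using sets_eq_imp_space_eq[OF \<open>sets p = sets borel\<close>] by simp
  have Y[measurable]: "Y i \<in> borel_measurable \<Omega>" if "i \<ge> 1" for i
    using \<open>\<Omega>.indep_vars _ _ _\<close> that by (auto simp: \<Omega>.indep_vars_def)
  have AE_Y: "AE \<omega> in \<Omega>. P (Y i \<omega>)" if "i \<ge> 1" "AE y in p. P y" for P i
    using that(2) unfolding assms(6)[OF that(1), symmetric] by (rule AE_distrD[OF Y[OF that(1)]])
  have E_Y: "\<Omega>.expectation (\<lambda>\<omega>. f (Y i \<omega>)) = p.expectation f"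
    if "i \<ge> 1" "f \<in> borel_measurable borel" for i and f :: "real^'d \<Rightarrow> real"
    using integral_distr[OF Y[OF that(1)] that(2)] assms(6)[OF that(1)] by simp

  define t where "t = target_centroid p k x"
  define \<mu> where "\<mu> = p.expectation (k x)"
  \<comment> \<open>By the triangle inequality, \<open>K\<close> bounds \<open>norm (y - t)\<close>
    almost surely.\<close>
  define K where "K = C + norm t"
  have \<mu>: "0 < \<mu>"
    using assms(12) by (simp add: \<mu>_def)
  have K: "0 \<le> K"
    using \<open>C > 0\<close> by (simp add: K_def)
  have pos: "AE y in p. 0 < k x y"
  proof (subst p.prob_Collect_eq_1[symmetric])
    show "{y \<in> space p. 0 < k x y} \<in> sets p" by measurable
  qed fact
  have k_int: "integrable p (k x)"
    using \<open>AE y in p. k x y \<in> {0..M}\<close>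
    by (intro p.integrable_const_bound[where B = M]) auto
  have ky_int: "integrable p (\<lambda>y. k x y *\<^sub>R y)"
  proof (rule p.integrable_const_bound)
    show "AE y in p. norm (k x y *\<^sub>R y) \<le> M * C"
      using \<open>AE y in p. k x y \<in> {0..M}\<close> \<open>AE y in p. norm y \<le> C\<close>
      by eventually_elim (auto intro!: mult_mono)
  qed measurable
  have centered: "p.expectation (\<lambda>y. k x y *\<^sub>R (y - t)) = 0"
    using k_int ky_int \<mu> by (simp add: scaleR_diff_right t_def target_centroid_def \<mu>_def)
  have kyt_int: "integrable p (\<lambda>y. k x y *\<^sub>R (y - t))"
    using k_int ky_int by (simp add: scaleR_diff_right)

  define R where "R n = 320 * K * M ^ 3 / (\<mu> * real n) ^ 3
    + 3 * K * exp (- (\<mu>\<^sup>2 / (8 * M\<^sup>2)) * real n)" for n :: nat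
  define G where "G n \<omega> = abc_centroid k x (\<lambda>i. Y i \<omega>) n - t" for n \<omega>

  \<comment> \<open>The summand estimate is for real variables, so the error is tested against unit
    vectors; the bound is uniform in \<open>u\<close>.\<close>
  have inner_bound: "\<bar>\<Omega>.expectation (\<lambda>\<omega>. G n \<omega> \<bullet> u)\<bar> \<le> n * R n"
    if n: "n \<ge> 2" and u: "norm u = 1" for n u
  proof -
    define V where "V y = k x y * ((y - t) \<bullet> u)" for y
    have [measurable]: "V \<in> borel_measurable borel"
      unfolding V_def by measurable
    define S where "S \<omega> = (\<Sum>i=1..n. k x (Y i \<omega>))" for \<omega>
    define Q where "Q \<omega> = (\<Sum>i=1..n. (k x (Y i \<omega>))\<^sup>2)" for \<omega>
    define F where "F j \<omega> = V (Y j \<omega>) *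
      (1 / S \<omega> - Q \<omega> / S \<omega> ^ 3 + k x (Y j \<omega>) / (S \<omega>)\<^sup>2)" for j \<omega>
    have EV: "\<Omega>.expectation (\<lambda>\<omega>. V (Y j \<omega>)) = 0" if "j \<ge> 1" for j
    proof -
      have "p.expectation V = p.expectation (\<lambda>y. (k x y *\<^sub>R (y - t)) \<bullet> u)"
        by (simp add: V_def[abs_def])
      also have "\<dots> = 0"
        using kyt_int by (simp only: integral_inner_left centered) simp
      finally show ?thesis
        using E_Y[OF that, of V] by simp
    qed
    have V_bound: "AE y in p. \<bar>V y\<bar> \<le> K * k x y"
      using \<open>AE y in p. k x y \<in> {0..M}\<close> \<open>AE y in p. norm y \<le> C\<close>
    proof eventually_elim
      case (elim y)
      have "\<bar>(y - t) \<bullet> u\<bar> \<le> norm (y - t)"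
        using Cauchy_Schwarz_ineq2[of "y - t" u] u by simp
      also have "\<dots> \<le> K"
        using elim norm_triangle_ineq4[of y t] by (simp add: K_def)
      finally show ?case
        using elim mult_right_mono[of "\<bar>(y - t) \<bullet> u\<bar>" K "k x y"]
        by (simp add: V_def abs_mult mult.commute)
    qed
    have F: "integrable \<Omega> (F j)" "\<bar>\<Omega>.expectation (F j)\<bar> \<le> R n" if "j \<in> {1..n}" for j
    proof -
      have indep: "\<Omega>.indep_vars (\<lambda>_. borel) Y {1..n}"
        using \<open>\<Omega>.indep_vars _ _ _\<close> by (rule \<Omega>.indep_vars_subset) auto
      note * = \<Omega>.abc_summand_expectation[OF _ indep that, of "k x" V M K \<mu>]
      show "integrable \<Omega> (F j)" "\<bar>\<Omega>.expectation (F j)\<bar> \<le> R n"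
        unfolding F_def S_def Q_def R_def
        using *[OF _ _ _ _ \<open>M > 0\<close> K AE_Y[OF _ assms(9)] AE_Y[OF _ V_bound] E_Y[of _ "k x", folded \<mu>_def] \<mu> EV]
          n that by auto
    qed
    \<comment> \<open>The decomposition requires a nonzero sum of weights, which almost sure
      positivity of every weight provides.\<close>
    have "AE \<omega> in \<Omega>. G n \<omega> \<bullet> u = (\<Sum>j=1..n. F j \<omega>)"
    proof -
      have "AE \<omega> in \<Omega>. \<forall>i\<in>{1..n}. 0 < k x (Y i \<omega>)"
        using AE_Y[OF _ pos] by (intro AE_finite_allI) auto
      then show ?thesis
      proof eventually_elim
        case (elim \<omega>)
        have "S \<omega> > 0"
          unfolding S_def using elim n by (intro sum_pos) auto
        then show ?case
          using abc_centroid_error[of k x "\<lambda>i. Y i \<omega>" n t]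
          by (simp add: G_def F_def V_def S_def Q_def inner_sum_left mult_ac)
      qed
    qed
    then have "\<Omega>.expectation (\<lambda>\<omega>. G n \<omega> \<bullet> u) = \<Omega>.expectation (\<lambda>\<omega>. \<Sum>j=1..n. F j \<omega>)"
    proof (intro integral_cong_AE)
      show "(\<lambda>\<omega>. \<Sum>j=1..n. F j \<omega>) \<in> borel_measurable \<Omega>"
        using F by (intro borel_measurable_sum) auto
      \<comment> \<open>\<open>Y i\<close> is known to be measurable only for
        \<open>i \<ge> 1\<close>, so the range of each sum matters.\<close>
      have "(\<lambda>\<omega>. G n \<omega>) \<in> borel_measurable \<Omega>"
        unfolding G_def abc_centroid_def plugin_correction_def minibatch_centroid_def
          normalized_weight_def
        by (intro borel_measurable_diff borel_measurable_sum borel_measurable_scaleR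
            borel_measurable_divide borel_measurable_power borel_measurable_const
            measurable_compose[OF Y \<open>k x \<in> borel_measurable borel\<close>] Y) auto
      then show "(\<lambda>\<omega>. G n \<omega> \<bullet> u) \<in> borel_measurable \<Omega>"
        by measurable
    qed
    also have "\<dots> = (\<Sum>j=1..n. \<Omega>.expectation (F j))"
      using F by (intro Bochner_Integration.integral_sum) auto
    also have "\<bar>\<dots>\<bar> \<le> (\<Sum>j=1..n. R n)"
      using F by (intro order_trans[OF sum_abs] sum_mono) auto
    finally show ?thesis
      by simp
  qed

  have "norm (\<Omega>.expectation (G n)) \<le> n * R n" if n: "n \<ge> 2" for n
  proof (cases "\<Omega>.expectation (G n) = 0")
    case True
    have "0 \<le> R n"
      unfolding R_def using K \<mu> \<open>M > 0\<close> by auto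
    with True show ?thesis by simp
  next
    case False
    define e where "e = \<Omega>.expectation (G n)"
    \<comment> \<open>Testing in the direction of the expectation itself recovers its norm.\<close>
    define u where "u = sgn e"
    \<comment> \<open>The integral of a non-integrable function is 0 by convention, so a nonzero
      expectation forces integrability.\<close>
    have "integrable \<Omega> (G n)"
      using False not_integrable_integral_eq by blast
    then have "\<Omega>.expectation (\<lambda>\<omega>. G n \<omega> \<bullet> u) = e \<bullet> u"
      by (simp add: e_def)
    moreover have "e \<bullet> u = norm e"
      using False by (simp add: u_def sgn_div_norm dot_square_norm power2_eq_square flip: e_def)
    moreover have "norm u = 1"
      using False by (simp add: u_def norm_sgn e_def)
    ultimately show ?thesis
      using inner_bound[OF n, of u] by (simp add: e_def)
  qed
  then have "(\<lambda>n. norm (\<Omega>.expectation (G n))) \<in> O(\<lambda>n. real n * R n)"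
    by (intro landau_o.big_mono eventually_sequentiallyI[of 2])
      (auto intro: order_trans[OF _ abs_ge_self])
  also have "(\<lambda>n. real n * R n) \<in> O(\<lambda>n. 1 / real n ^ 2)"
  proof -
    define r where "r = \<mu>\<^sup>2 / (8 * M\<^sup>2)"
    have r: "0 < r"
      using \<mu> \<open>M > 0\<close> by (simp add: r_def)
    \<comment> \<open>This bound holds for every \<open>n\<close>: at \<open>n = 0\<close> both
      sides are 0 by division by zero.\<close>
    have "(\<lambda>n. real n * (320 * K * M ^ 3 / (\<mu> * real n) ^ 3)) \<in> O(\<lambda>n. 1 / real n ^ 2)"
    proof (intro bigoI[where c = "320 * K * M ^ 3 / \<mu> ^ 3"] always_eventually allI)
      fix n
      show "norm (real n * (320 * K * M ^ 3 / (\<mu> * real n) ^ 3))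
          \<le> 320 * K * M ^ 3 / \<mu> ^ 3 * norm (1 / real n ^ 2)"
        using K \<mu> \<open>M > 0\<close>
        by (simp add: power_mult_distrib abs_mult power2_eq_square power3_eq_cube mult_ac)
    qed
    moreover have "(\<lambda>n. real n * exp (- r * real n)) \<in> O(\<lambda>n. 1 / real n ^ 2)"
      using r by real_asymp
    then have "(\<lambda>n. 3 * K * (real n * exp (- r * real n))) \<in> O(\<lambda>n. 1 / real n ^ 2)"
      by simp
    ultimately show ?thesis
      unfolding R_def r_def[symmetric] by (simp add: distrib_left mult_ac sum_in_bigo)
  qed
  finally show ?thesis
    by (simp add: G_def[abs_def] t_def)
qed

end
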